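(* Let $X$ be a complete metric space, let $U:\{(t,s)\in\mathbb{R}^2:t\ge s\}\times X\to X$ be a continuous process having the pullback attractor $\mathcal{A}=\{\mathcal{A}(t)\}_{t\in\mathbb{R}}$, and let $S:\mathbb{R}^+\times X\to X$ be a continuous semigroup possessing the global attractor $\mathcal{A}_\infty$. Let $U$ be asymptotically autonomous with limit semigroup $S$, and forward asymptotically compact. Assume that $$dist_H(\mathcal{A}(t),\mathcal{A}_\infty)\to0\quad\text{as }t\to+\infty.$$ Then $\mathcal{A}$ is a forward attractor.
   Context: Let $\rho$ be the metric of $X$. For $A,B\subset X$, $dist(A,B)=\sup_{y\in A}\inf_{x\in B}\rho(y,x)$ and $dist_H(A,B)=\max\{dist(A,B),dist(B,A)\}$. A continuous process satisfies: $U(s,s,x)=x$; $U(t,s,x)=U(t,\tau,U(\tau,s,x))$ for $s\le\tau\le t$; and $(t,s,x)\mapsto U(t,s,x)$ is continuous. A continuous semigroup satisfies: $S(0,x)=x$; $S(t+s,x)=S(t,S(s,x))$ for $0\le s\le t$; and $(t,x)\mapsto S(t,x)$ is continuous. Images of sets are denoted $U(t,s,B)$, $S(t,B)$. A family $\{K(t)\}_{t\in\mathbb{R}}$ is invariant if $K(t)=U(t,s,K(s))$ for all $t\ge s$. A family of non-empty sets $\mathcal{A}=\{\mathcal{A}(t)\}$ is pullback attracting if for every bounded $B\subset X$ and every fixed $t$, $dist(U(t,t_0,B),\mathcal{A}(t))\to0$ as $t_0\to-\infty$; it is forward attracting if for every bounded $B\subset X$ and every fixed $t_0$, $dist(U(t,t_0,B),\mathcal{A}(t))\to0$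 as $t\to+\infty$. A pullback attractor is a family of non-empty compact invariant sets that is the minimal pullback attracting family of closed sets (i.e. it is pullback attracting and contained, for each $t$, in any pullback attracting family of closed sets). A forward attractor is a family of non-empty compact invariant sets that is forward attracting. A global attractor of $S$ is a compact set $\mathcal{A}_\infty$ with $S(t,\mathcal{A}_\infty)=\mathcal{A}_\infty$ for all $t\ge0$ and $dist(S(t,B),\mathcal{A}_\infty)\to0$ as $t\to+\infty$ for every bounded $B$. $U$ is asymptotically autonomous with limit semigroup $S$ if for any sequences $\tau_n\to+\infty$ and $x_n\to x_0$ in $X$ we have $U(t+\tau_n,\tau_n,x_n)\to S(t,x_0)$ as $n\to\infty$ for all $t\ge0$. $U$ is forward asymptotically compact if for every $t_0\in\mathbb{R}$, every bounded $B\subset X$ and all $t_n\to+\infty$, every sequence $y_n\in U(t_n,t_0,B)$ has a converging subsequence. *)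

theory Defs
  imports "HOL-Analysis.Analysis"
begin

(* The semidistance takes values in the extended non-negative reals, because its first argument
   need not be bounded and its second argument need not be compact. There the supremum over the
   empty set is 0 and the infimum over the empty set is infinity. *)
definition hausdorff_semidist :: "'a::metric_space set \<Rightarrow> 'a set \<Rightarrow> ennreal" where
  "hausdorff_semidist A B = (SUP y\<in>A. INF x\<in>B. ennreal (dist y x))"

definition hausdorff_dist :: "'a::metric_space set \<Rightarrow> 'a set \<Rightarrow> ennreal" where
  "hausdorff_dist A B = max (hausdorff_semidist A B) (hausdorff_semidist B A)"

(* A process is a total function here, but its values U t s x with t < s are junk: every
   condition below only constrains or uses U t s x for s <= t. Limits in which the order of the
   two times is not required explicitly only involve s <= t eventually. In the same way, values
   S t x of a semigroup with t < 0 are junk. *)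
definition continuous_process :: "(real \<Rightarrow> real \<Rightarrow> 'a::metric_space \<Rightarrow> 'a) \<Rightarrow> bool" where
  "continuous_process U \<longleftrightarrow>
     (\<forall>s x. U s s x = x) \<and>
     (\<forall>s \<tau> t x. s \<le> \<tau> \<and> \<tau> \<le> t \<longrightarrow> U t s x = U t \<tau> (U \<tau> s x)) \<and>
     continuous_on {(t, s, x). s \<le> t} (\<lambda>(t, s, x). U t s x)"

definition continuous_semigroup :: "(real \<Rightarrow> 'a::metric_space \<Rightarrow> 'a) \<Rightarrow> bool" where
  "continuous_semigroup S \<longleftrightarrow>
     (\<forall>x. S 0 x = x) \<and>
     (\<forall>s t x. 0 \<le> s \<and> s \<le> t \<longrightarrow> S (t + s) x = S t (S s x)) \<and>
     continuous_on ({0..} \<times> UNIV) (\<lambda>(t, x). S t x)"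

definition invariant_family :: "(real \<Rightarrow> real \<Rightarrow> 'a \<Rightarrow> 'a) \<Rightarrow> (real \<Rightarrow> 'a set) \<Rightarrow> bool" where
  "invariant_family U K \<longleftrightarrow> (\<forall>s t. s \<le> t \<longrightarrow> K t = U t s ` K s)"

definition pullback_attracting ::
    "(real \<Rightarrow> real \<Rightarrow> 'a::metric_space \<Rightarrow> 'a) \<Rightarrow> (real \<Rightarrow> 'a set) \<Rightarrow> bool" where
  "pullback_attracting U A \<longleftrightarrow>
     (\<forall>t. A t \<noteq> {}) \<and>
     (\<forall>B t. bounded B \<longrightarrow> ((\<lambda>t0. hausdorff_semidist (U t t0 ` B) (A t)) \<longlongrightarrow> 0) at_bot)"

definition forward_attracting ::
    "(real \<Rightarrow> real \<Rightarrow> 'a::metric_space \<Rightarrow> 'a) \<Rightarrow> (real \<Rightarrow> 'a set) \<Rightarrow> bool" where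
  "forward_attracting U A \<longleftrightarrow>
     (\<forall>t. A t \<noteq> {}) \<and>
     (\<forall>B t0. bounded B \<longrightarrow> ((\<lambda>t. hausdorff_semidist (U t t0 ` B) (A t)) \<longlongrightarrow> 0) at_top)"

definition pullback_attractor ::
    "(real \<Rightarrow> real \<Rightarrow> 'a::metric_space \<Rightarrow> 'a) \<Rightarrow> (real \<Rightarrow> 'a set) \<Rightarrow> bool" where
  "pullback_attractor U A \<longleftrightarrow>
     (\<forall>t. A t \<noteq> {} \<and> compact (A t)) \<and>
     invariant_family U A \<and>
     pullback_attracting U A \<and>
     (\<forall>C. (\<forall>t. closed (C t)) \<and> pullback_attracting U C \<longrightarrow> (\<forall>t. A t \<subseteq> C t))"

definition forward_attractor ::
    "(real \<Rightarrow> real \<Rightarrow> 'a::metric_space \<Rightarrow> 'a) \<Rightarrow> (real \<Rightarrow> 'a set) \<Rightarrow> bool" where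
  "forward_attractor U A \<longleftrightarrow>
     (\<forall>t. A t \<noteq> {} \<and> compact (A t)) \<and>
     invariant_family U A \<and>
     forward_attracting U A"

definition global_attractor :: "(real \<Rightarrow> 'a::metric_space \<Rightarrow> 'a) \<Rightarrow> 'a set \<Rightarrow> bool" where
  "global_attractor S A \<longleftrightarrow>
     compact A \<and>
     (\<forall>t\<ge>0. S t ` A = A) \<and>
     (\<forall>B. bounded B \<longrightarrow> ((\<lambda>t. hausdorff_semidist (S t ` B) A) \<longlongrightarrow> 0) at_top)"

definition asymptotically_autonomous ::
    "(real \<Rightarrow> real \<Rightarrow> 'a::metric_space \<Rightarrow> 'a) \<Rightarrow> (real \<Rightarrow> 'a \<Rightarrow> 'a) \<Rightarrow> bool" where
  "asymptotically_autonomous U S \<longleftrightarrow>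
     (\<forall>(\<tau> :: nat \<Rightarrow> real) x x0. filterlim \<tau> at_top sequentially \<and> x \<longlonglongrightarrow> x0 \<longrightarrow>
        (\<forall>t\<ge>0. (\<lambda>n. U (t + \<tau> n) (\<tau> n) (x n)) \<longlonglongrightarrow> S t x0))"

definition forward_asymptotically_compact ::
    "(real \<Rightarrow> real \<Rightarrow> 'a::metric_space \<Rightarrow> 'a) \<Rightarrow> bool" where
  "forward_asymptotically_compact U \<longleftrightarrow>
     (\<forall>t0 B (t :: nat \<Rightarrow> real) y.
        bounded B \<and> filterlim t at_top sequentially \<and>
        (\<forall>n. t0 \<le> t n \<and> y n \<in> U (t n) t0 ` B) \<longrightarrow>
        (\<exists>r l. strict_mono r \<and> (y \<circ> r) \<longlonglongrightarrow> l))"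

end

(* Suppose some bounded B is not attracted forward in time. Forward asymptotic compactness gives
   t n -> infinity and x n in B such that the points U (t n) t0 (x n) stay away from A (t n) but
   converge to some y. For every k >= 0, passing to a limit of U (t n - k) t0 (x n) along a
   subsequence, asymptotic autonomy yields y = S k z with z in the omega-limit set of B. That set
   is bounded, so it is attracted by A_inf under S, and as k is arbitrary y lies in A_inf. Since
   A (t n) approximates A_inf, this contradicts the choice of the points. *)
theory Submission
  imports Defs
begin

lemma hausdorff_semidist_lessD:
  assumes "hausdorff_semidist A B < ennreal e" "y \<in> A"
  shows "\<exists>x\<in>B. dist y x < e"
proof -
  have "(INF x\<in>B. ennreal (dist y x)) < ennreal e"
    using assms unfolding hausdorff_semidist_def by (meson SUP_upper order_le_less_trans)
  then show ?thesis
    by (auto simp: INF_less_iff ennreal_less_iff)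
qed

lemma hausdorff_semidist_leI:
  assumes "\<And>y. y \<in> A \<Longrightarrow> \<exists>x\<in>B. dist y x \<le> e"
  shows "hausdorff_semidist A B \<le> ennreal e"
  unfolding hausdorff_semidist_def
proof (rule SUP_least)
  fix y assume "y \<in> A"
  then obtain x where "x \<in> B" "dist y x \<le> e"
    using assms by blast
  then show "(INF x\<in>B. ennreal (dist y x)) \<le> ennreal e"
    by (meson INF_lower2 ennreal_leI)
qed

text \<open>Attraction becomes an epsilon statement about points. A strict bound on an infimum
  yields a witness even when the infimum is not attained; conversely, pointwise bounds survive the
  supremum only as \<open>\<le>\<close>, so some room below the target value is required.\<close>

lemma hausdorff_semidist_tendsto_0_iff:
  "((\<lambda>t. hausdorff_semidist (F t) (G t)) \<longlongrightarrow> 0) L \<longleftrightarrow>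
     (\<forall>e>0. \<forall>\<^sub>F t in L. \<forall>y\<in>F t. \<exists>x\<in>G t. dist y x < e)"
proof (intro iffI allI impI)
  fix e :: real
  assume lim: "((\<lambda>t. hausdorff_semidist (F t) (G t)) \<longlongrightarrow> 0) L" and "e > 0"
  then have "\<forall>\<^sub>F t in L. hausdorff_semidist (F t) (G t) < ennreal e"
    by (intro order_tendstoD(2)[OF lim]) simp
  then show "\<forall>\<^sub>F t in L. \<forall>y\<in>F t. \<exists>x\<in>G t. dist y x < e"
    by eventually_elim (blast dest: hausdorff_semidist_lessD)
next
  assume *: "\<forall>e>0. \<forall>\<^sub>F t in L. \<forall>y\<in>F t. \<exists>x\<in>G t. dist y x < e"
  show "((\<lambda>t. hausdorff_semidist (F t) (G t)) \<longlongrightarrow> 0) L"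
  proof (rule order_tendstoI)
    fix a :: ennreal assume "0 < a"
    \<comment> \<open>The bound \<open>a\<close> may be infinite. Density of the order gives
      \<open>q\<close> strictly below it, hence finite, and its real value \<open>r\<close> serves
      as epsilon.\<close>
    then obtain q where q: "0 < q" "q < a"
      using dense by blast
    define r where "r = enn2real q"
    have "ennreal r = q"
      unfolding r_def using q(2) by (intro ennreal_enn2real) (rule less_le_trans, auto)
    with q have r: "0 < ennreal r" "ennreal r < a"
      by auto
    then have "\<forall>\<^sub>F t in L. \<forall>y\<in>F t. \<exists>x\<in>G t. dist y x < r"
      using * by simp
    then show "\<forall>\<^sub>F t in L. hausdorff_semidist (F t) (G t) < a"
    proof eventually_elim
      case (elim t)
      then have "hausdorff_semidist (F t) (G t) \<le> ennreal r"
        by (intro hausdorff_semidist_leI) (meson less_imp_le)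
      with r show ?case by simp
    qed
  qed simp
qed

lemma forward_asymptotically_compactD:
  fixes t :: "nat \<Rightarrow> real"
  assumes "forward_asymptotically_compact U" "bounded B" "filterlim t at_top sequentially"
    and "\<And>n. t0 \<le> t n" "\<And>n. x n \<in> B"
  obtains r l where "strict_mono r" "(\<lambda>n. U (t (r n)) t0 (x (r n))) \<longlonglongrightarrow> l"
proof -
  obtain r l where "strict_mono r" "((\<lambda>n. U (t n) t0 (x n)) \<circ> r) \<longlonglongrightarrow> l"
    using assms(1)[unfolded forward_asymptotically_compact_def, rule_format, of B t t0 "\<lambda>n. U (t n) t0 (x n)"]
      assms(2-) by blast
  with that show thesis
    by (simp add: o_def)
qed

text \<open>If every tail were unbounded, some orbit points at times tending to infinity would
  escape from a fixed centre \<open>p\<close>; compactness would give them a convergent, hence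
  bounded, subsequence. The bounded tail is later a set that the semigroup attracts.\<close>

lemma eventually_bounded_orbit:
  assumes fac: "forward_asymptotically_compact U" and B: "bounded B"
  obtains T where "bounded (\<Union>t\<in>{T..}. U t t0 ` B)"
proof (rule ccontr)
  fix p
  assume "\<not> thesis"
  then have unb: "\<not> bounded (\<Union>t\<in>{T..}. U t t0 ` B)" for T
    using that by blast
  \<comment> \<open>The maximum drives the times to infinity and also keeps them at or after
    \<open>t0\<close>, where \<open>U\<close> is meaningful.\<close>
  have "\<exists>t x. max t0 (real n) \<le> t \<and> x \<in> B \<and> real n < dist p (U t t0 x)" for n :: nat
    using unb[of "max t0 (real n)"] unfolding bounded_def by (force simp: not_le)
  then obtain t x where tx: "\<And>n. max t0 (real n) \<le> t n" "\<And>n. x n \<in> B"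
      "\<And>n. real n < dist p (U (t n) t0 (x n))"
    by metis
  have "filterlim t at_top sequentially"
    by (rule filterlim_at_top_mono[OF filterlim_real_sequentially]) (use tx(1) in auto)
  then obtain r l where r: "strict_mono r" "(\<lambda>n. U (t (r n)) t0 (x (r n))) \<longlonglongrightarrow> l"
    using forward_asymptotically_compactD[OF fac B, of t t0 x] tx(1,2) by auto
  have "bounded (range (\<lambda>n. U (t (r n)) t0 (x (r n))))"
    using r(2) convergent_def convergent_imp_bounded by blast
  then obtain K where K: "\<And>n. dist p (U (t (r n)) t0 (x (r n))) \<le> K"
    unfolding bounded_any_center[where a = p] by auto
  obtain n where "K < real n"
    using reals_Archimedean2 by blast
  also have "real n \<le> real (r n)"
    using r(1) by (simp add: seq_suble)
  finally show False
    using K[of n] tx(3)[of "r n"] by linarith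
qed

text \<open>The limit \<open>y\<close> has a preimage under every \<open>S k\<close> in one bounded
  set \<open>W\<close> that does not depend on \<open>k\<close>. Attraction of \<open>W\<close> puts
  \<open>y\<close> arbitrarily close to \<open>K\<close>, which is closed.\<close>

lemma orbit_limit_in_global_attractor:
  fixes t :: "nat \<Rightarrow> real"
  assumes U: "continuous_process U" and K: "global_attractor S K"
    and aa: "asymptotically_autonomous U S" and fac: "forward_asymptotically_compact U"
    and B: "bounded B" "\<And>n. x n \<in> B"
    and t: "filterlim t at_top sequentially"
    and y: "(\<lambda>n. U (t n) t0 (x n)) \<longlonglongrightarrow> y"
  shows "y \<in> K"
proof -
  obtain T where T: "bounded (\<Union>t\<in>{T..}. U t t0 ` B)"
    using eventually_bounded_orbit[OF fac B(1)] .
  \<comment> \<open>Taking the closure keeps \<open>W\<close> bounded and lets it contain limits of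
    late orbit points.\<close>
  define W where "W = closure (\<Union>t\<in>{T..}. U t t0 ` B)"
  have pre: "y \<in> S k ` W" if "k \<ge> 0" for k
  proof -
    \<comment> \<open>Going back by \<open>k\<close> could precede \<open>t0\<close> for small
      \<open>n\<close>; the maximum prevents this and is eventually just
      \<open>t n - k\<close>.\<close>
    define s where "s n = max t0 (t n - k)" for n
    have "filterlim (\<lambda>n. -k + t n) at_top sequentially"
      by (rule filterlim_tendsto_add_at_top[OF tendsto_const t])
    then have s: "filterlim s at_top sequentially"
      by (rule filterlim_at_top_mono) (simp add: s_def)
    then obtain r z where r: "strict_mono r" "(\<lambda>n. U (s (r n)) t0 (x (r n))) \<longlonglongrightarrow> z"
      using forward_asymptotically_compactD[OF fac B(1), of s t0 x] B(2) by (auto simp: s_def)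
    have sr: "filterlim (\<lambda>n. s (r n)) at_top sequentially"
      and tr: "filterlim (\<lambda>n. t (r n)) at_top sequentially"
      using s t filterlim_subseq[OF r(1)] by (auto intro: filterlim_compose)
    have "\<forall>\<^sub>F n in sequentially. U (s (r n)) t0 (x (r n)) \<in> W"
      using filterlim_at_top[THEN iffD1, OF sr, rule_format, of T]
    proof eventually_elim
      case (elim n)
      then have "U (s (r n)) t0 (x (r n)) \<in> (\<Union>t\<in>{T..}. U t t0 ` B)"
        using B(2) by auto
      then show ?case
        unfolding W_def by (rule subsetD[OF closure_subset])
    qed
    then have "z \<in> W"
      using r(2) by (intro Lim_in_closed_set[of W]) (auto simp: W_def)
    \<comment> \<open>Asymptotic autonomy is applied to the convergent points reached at times
      \<open>s (r n)\<close>; the process law then identifies the left side with the original orbit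
      points.\<close>
    have "(\<lambda>n. U (k + s (r n)) (s (r n)) (U (s (r n)) t0 (x (r n)))) \<longlonglongrightarrow> S k z"
      using aa sr r(2) that unfolding asymptotically_autonomous_def by blast
    moreover have "\<forall>\<^sub>F n in sequentially.
        U (k + s (r n)) (s (r n)) (U (s (r n)) t0 (x (r n))) = U (t (r n)) t0 (x (r n))"
      using filterlim_at_top[THEN iffD1, OF tr, rule_format, of "t0 + k"]
    proof eventually_elim
      case (elim n)
      then have "k + s (r n) = t (r n)" "t0 \<le> s (r n)" "s (r n) \<le> t (r n)"
        using that by (auto simp: s_def)
      then show ?case
        using U unfolding continuous_process_def by simp
    qed
    ultimately have "(\<lambda>n. U (t (r n)) t0 (x (r n))) \<longlonglongrightarrow> S k z"
      by (rule Lim_transform_eventually)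
    moreover have "(\<lambda>n. U (t (r n)) t0 (x (r n))) \<longlonglongrightarrow> y"
      using LIMSEQ_subseq_LIMSEQ[OF y r(1)] by (simp add: o_def)
    ultimately have "y = S k z"
      by (rule LIMSEQ_unique[rotated])
    with \<open>z \<in> W\<close> show ?thesis by blast
  qed
  have "\<exists>a\<in>K. dist a y < e" if "e > 0" for e
  proof -
    have "bounded W"
      unfolding W_def using T by (rule bounded_closure)
    then have "\<forall>\<^sub>F k in at_top. \<forall>w\<in>S k ` W. \<exists>a\<in>K. dist w a < e"
      using K that unfolding global_attractor_def hausdorff_semidist_tendsto_0_iff by simp
    \<comment> \<open>The body no longer mentions \<open>k\<close>, so a single large
      \<open>k\<close> settles the claim.\<close>
    then have "\<forall>\<^sub>F k :: real in at_top. \<exists>a\<in>K. dist y a < e"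
      using eventually_ge_at_top[of 0]
      by eventually_elim (use pre in blast)
    then show ?thesis
      by (auto simp: dist_commute dest: eventually_happens)
  qed
  then have "y \<in> closure K"
    by (simp add: closure_approachable)
  then show ?thesis
    using K by (simp add: global_attractor_def compact_imp_closed)
qed

theorem theorem14:
  fixes U :: "real \<Rightarrow> real \<Rightarrow> 'a::complete_space \<Rightarrow> 'a"
    and S :: "real \<Rightarrow> 'a \<Rightarrow> 'a"
    and A :: "real \<Rightarrow> 'a set"
    and A_inf :: "'a set"
  assumes "continuous_process U"
    and "pullback_attractor U A"
    and "continuous_semigroup S"
    and "global_attractor S A_inf"
    and "asymptotically_autonomous U S"
    and "forward_asymptotically_compact U"
    and "((\<lambda>t. hausdorff_dist (A t) A_inf) \<longlongrightarrow> 0) at_top"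
  shows "forward_attractor U A"
proof -
  have near: "\<forall>\<^sub>F t in at_top. \<forall>y\<in>A_inf. \<exists>a\<in>A t. dist y a < e" if "e > 0" for e
  proof -
    \<comment> \<open>This semidistance is one of the two terms of the maximum
      \<open>hausdorff_dist\<close>.\<close>
    have "((\<lambda>t. hausdorff_semidist A_inf (A t)) \<longlongrightarrow> 0) at_top"
      by (rule tendsto_sandwich[OF _ _ tendsto_const assms(7)])
        (auto simp: hausdorff_dist_def)
    with that show ?thesis
      by (simp add: hausdorff_semidist_tendsto_0_iff)
  qed
  have attr: "\<forall>\<^sub>F t in at_top. \<forall>y\<in>U t t0 ` B. \<exists>a\<in>A t. dist y a < e"
    if B: "bounded B" and e: "e > 0" for B t0 e
  proof (rule ccontr)
    assume not_attr: "\<not> ?thesis"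
    have "\<exists>t\<ge>max t0 (real n). \<exists>x\<in>B. \<forall>a\<in>A t. e \<le> dist (U t t0 x) a" for n
    proof -
      have "\<not> (\<forall>t\<ge>max t0 (real n). \<forall>y\<in>U t t0 ` B. \<exists>a\<in>A t. dist y a < e)"
        using not_attr unfolding eventually_at_top_linorder by blast
      then obtain t x where "t \<ge> max t0 (real n)" "x \<in> B" "\<not> (\<exists>a\<in>A t. dist (U t t0 x) a < e)"
        by blast
      then show ?thesis
        by (intro exI[of _ t] conjI bexI[of _ x] ballI) (simp_all add: not_less)
    qed
    then obtain t x where t: "\<And>n. max t0 (real n) \<le> t n" and x: "\<And>n. x n \<in> B"
      and far: "\<And>n a. a \<in> A (t n) \<Longrightarrow> e \<le> dist (U (t n) t0 (x n)) a"
      by metis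
    have lim_t: "filterlim t at_top sequentially"
      by (rule filterlim_at_top_mono[OF filterlim_real_sequentially]) (use t in auto)
    then obtain r y where r: "strict_mono r" and y: "(\<lambda>n. U (t (r n)) t0 (x (r n))) \<longlonglongrightarrow> y"
      using forward_asymptotically_compactD[OF assms(6) B, of t t0 x] t x by auto
    have tr: "filterlim (\<lambda>n. t (r n)) at_top sequentially"
      using lim_t filterlim_subseq[OF r] by (rule filterlim_compose)
    have "y \<in> A_inf"
      using orbit_limit_in_global_attractor[OF assms(1,4,5,6) B _ tr y] x by simp
    then have "\<forall>\<^sub>F t in at_top. \<exists>a\<in>A t. dist y a < e / 2"
      using near[of "e / 2"] e by (auto elim: eventually_mono)
    then have "\<forall>\<^sub>F n in sequentially. \<exists>a\<in>A (t (r n)). dist y a < e / 2"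
      using tr by (rule eventually_compose_filterlim)
    moreover have "\<forall>\<^sub>F n in sequentially. dist (U (t (r n)) t0 (x (r n))) y < e / 2"
      by (rule tendstoD[OF y]) (use e in simp)
    \<comment> \<open>One half of \<open>e\<close> pays for replacing the orbit point by
      \<open>y\<close>, the other for replacing \<open>y\<close> by a point of
      \<open>A (t (r n))\<close>; their sum contradicts \<open>far\<close>.\<close>
    ultimately have "\<forall>\<^sub>F n in sequentially. False"
    proof eventually_elim
      case (elim n)
      then obtain a where "a \<in> A (t (r n))" "dist y a < e / 2"
        by blast
      with elim(2) have "dist (U (t (r n)) t0 (x (r n))) a < e"
        using dist_triangle[of "U (t (r n)) t0 (x (r n))" a y] by simp
      with far[OF \<open>a \<in> A (t (r n))\<close>] show ?case
        by simp
    qed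
    then show False by simp
  qed
  show ?thesis
    using assms(2) attr
    unfolding forward_attractor_def forward_attracting_def pullback_attractor_def
      hausdorff_semidist_tendsto_0_iff
    by simp
qed

end
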